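(* For every positive integer $n$ there exists a balanced bipartite graph $G$ of maximum degree four that has a $\{P_2,P_3\}$-factor, such that for every odd positive integer $i\le n$ the Cartesian product $G\Box P_i$ is not hamiltonian.
   Context: Graphs are finite and simple. $P_m$ denotes the path on $m$ vertices. A $\{P_2,P_3\}$-factor of a graph $G$ is a spanning subgraph of $G$ in which every component is a path on two or three vertices. A bipartite graph is balanced if it has a bipartition into two classes of equal size. The Cartesian product $G\Box H$ has vertex set $V(G)\times V(H)$, and $(g_1,h_1)$, $(g_2,h_2)$ are adjacent if and only if either $g_1=g_2$ and $h_1h_2\in E(H)$, or $g_1g_2\in E(G)$ and $h_1=h_2$. A graph is hamiltonian if it contains a cycle through all its vertices. *)

theory Defs
  imports Complex_Main "Graph_Theory.Graph_Theory"
begin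

text \<open>
  A finite simple graph is a \<^locale>\<open>pair_graph\<close>: a finite, loop-free, symmetric set of ordered
  pairs over a vertex set, in which an undirected edge \<open>uv\<close> is the pair of arcs \<open>(u,v)\<close>, \<open>(v,u)\<close>.
  Hence the degree of a vertex is its \<^const>\<open>out_degree\<close>.
\<close>

definition path_graph :: "nat \<Rightarrow> nat pair_pre_digraph" where
  "path_graph m = \<lparr> pverts = {..<m}, parcs = {(i, j). i < m \<and> j < m \<and> (j = Suc i \<or> i = Suc j)} \<rparr>"

definition cartesian_product ::
  "'a pair_pre_digraph \<Rightarrow> 'b pair_pre_digraph \<Rightarrow> ('a \<times> 'b) pair_pre_digraph" where
  "cartesian_product G H = \<lparr>
     pverts = pverts G \<times> pverts H,
     parcs = {((g1, h1), (g2, h2)) | g1 h1 g2 h2.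
       (g1 = g2 \<and> g1 \<in> pverts G \<and> (h1, h2) \<in> parcs H) \<or>
       ((g1, g2) \<in> parcs G \<and> h1 = h2 \<and> h1 \<in> pverts H)} \<rparr>"

definition balanced_bipartite :: "'a pair_pre_digraph \<Rightarrow> bool" where
  "balanced_bipartite G \<longleftrightarrow> (\<exists>X Y. X \<union> Y = pverts G \<and> X \<inter> Y = {} \<and> card X = card Y \<and>
     parcs G \<subseteq> X \<times> Y \<union> Y \<times> X)"

text \<open>\<open>SUP\<close> rather than \<open>Max\<close>, so that the graph without vertices gets the value \<open>0\<close>.\<close>

definition max_degree :: "'a pair_pre_digraph \<Rightarrow> nat" where
  "max_degree G = (SUP v\<in>pverts G. out_degree G v)"

definition is_component :: "'a pair_pre_digraph \<Rightarrow> 'a pair_pre_digraph \<Rightarrow> bool" where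
  "is_component G C \<longleftrightarrow> pre_digraph.max_subgraph G connected C"

definition has_P2_P3_factor :: "'a pair_pre_digraph \<Rightarrow> bool" where
  "has_P2_P3_factor G \<longleftrightarrow> (\<exists>F :: 'a pair_pre_digraph. pair_graph F \<and> spanning F G \<and>
     (\<forall>C. is_component F C \<longrightarrow> digraph_iso C (path_graph 2) \<or> digraph_iso C (path_graph 3)))"

text \<open>
  The library's \<open>cycle\<close> is a closed arc walk without repeated vertices. In a symmetric digraph
  it also admits \<open>u, v, u\<close>, which is not a cycle of the undirected graph; the
  length bound excludes it.
\<close>

definition hamiltonian :: "'a pair_pre_digraph \<Rightarrow> bool" where
  "hamiltonian G \<longleftrightarrow> (\<exists>p. pre_digraph.cycle G p \<and> length p \<ge> 3 \<and> fst ` set p = pverts G)"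

end

theory Submission
  imports Defs
begin

text \<open>
  A hamiltonian cycle sends every vertex to its successor, injectively and along an arc; so every
  set \<open>M\<close> of vertices has at least \<open>card M\<close> neighbours. The graph \<open>G\<close> is a chain of \<open>2m\<close> copies of
  \<open>P\<^sub>3\<close> whose first half has the leaves of the \<open>P\<^sub>3\<close>s in one colour class and the centres in the
  other, an imbalance of \<open>m\<close>; the second half has the colours exchanged, and a single edge joins
  the halves. For odd \<open>i\<close> the larger colour class \<open>M\<close> of (first half) \<open>\<box> P\<^sub>i\<close> still exceeds the
  smaller one by \<open>m\<close>, whereas \<open>M\<close> has at most \<open>i\<close> neighbours outside the first half. Hence
  \<open>G \<box> P\<^sub>i\<close> is not hamiltonian once \<open>m > i\<close>.
\<close>

section \<open>A necessary condition for hamiltonicity\<close>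

lemma hamiltonian_card_le_card_neighbours:
  fixes G :: "'a pair_pre_digraph"
  assumes "hamiltonian G" and "M \<subseteq> pverts G" and "finite N"
    and nbr: "\<And>u v. u \<in> M \<Longrightarrow> (u, v) \<in> parcs G \<Longrightarrow> v \<in> N"
  shows "card M \<le> card N"
proof -
  obtain p where cyc: "pre_digraph.cycle G p" and cov: "fst ` set p = pverts G"
    using assms(1) unfolding hamiltonian_def by blast
  obtain u where walk: "pre_digraph.awalk G u p u"
    and dist: "distinct (tl (pre_digraph.awalk_verts G u p))" and "p \<noteq> []"
    using cyc unfolding pre_digraph.cycle_def by blast
  have arcs: "set p \<subseteq> parcs G" and cas: "pre_digraph.cas G u p u"
    using walk by (auto simp: pre_digraph.awalk_def)
  \<comment> \<open>The vertex list of a nonempty walk is its start followed by the heads of its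
    arcs, so no two arcs of the cycle share a head.\<close>
  have "distinct (map snd p)"
    using dist \<open>p \<noteq> []\<close> pre_digraph.awalk_verts_conv'[OF cas] by simp
  then have inj: "inj_on snd (set p)"
    by (simp add: distinct_map)
  define E where "E = {e \<in> set p. fst e \<in> M}"
  have "M \<subseteq> fst ` E"
  proof
    fix v assume "v \<in> M"
    then have "v \<in> fst ` set p"
      using cov \<open>M \<subseteq> pverts G\<close> by blast
    then show "v \<in> fst ` E"
      using \<open>v \<in> M\<close> by (auto simp: E_def)
  qed
  then have "card M \<le> card E"
    by (rule surj_card_le[rotated]) (simp add: E_def)
  also have "card E = card (snd ` E)"
    using inj by (subst card_image) (auto simp: E_def intro: inj_on_subset)
  also have "\<dots> \<le> card N"
    using arcs nbr \<open>finite N\<close> by (intro card_mono) (auto simp: E_def)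
  finally show ?thesis .
qed

section \<open>The chain and its balanced colouring\<close>

text \<open>Here \<open>\<noteq>\<close> acts as exclusive or, so a move by \<open>3 * m\<close>
  from one half to the other flips the colour.\<close>

definition colour :: "nat \<Rightarrow> nat \<Rightarrow> bool" where
  "colour m v \<longleftrightarrow> (v mod 3 = 1) \<noteq> (v < 3 * m)"

text \<open>
  The \<open>k\<close>-th copy of \<open>P\<^sub>3\<close> is \<open>3k, 3k+1, 3k+2\<close>. Each centre \<open>3k+1\<close> is moreover adjacent to the
  nearest leaf of either neighbouring copy in the same half; the edge between the halves
  joins the leaves \<open>3m-1\<close> and \<open>3m\<close>.
\<close>

definition P3_chain :: "nat \<Rightarrow> nat pair_pre_digraph" where
  "P3_chain m = \<lparr> pverts = {..<6 * m},
     parcs = {(u, v). u < 6 * m \<and> v < 6 * m \<and> u \<le> v + 2 \<and> v \<le> u + 2 \<and> colour m u \<noteq> colour m v} \<rparr>"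

text \<open>This will be the factor; its components are the \<open>P3_copy k\<close> with
  \<open>k < 2 * m\<close>.\<close>

definition P3_copies :: "nat \<Rightarrow> nat pair_pre_digraph" where
  "P3_copies m = \<lparr> pverts = {..<6 * m},
     parcs = {(u, v). u < 6 * m \<and> v < 6 * m \<and> u div 3 = v div 3 \<and> (v = Suc u \<or> u = Suc v)} \<rparr>"

definition P3_copy :: "nat \<Rightarrow> nat pair_pre_digraph" where
  "P3_copy k = \<lparr> pverts = {3 * k, 3 * k + 1, 3 * k + 2},
     parcs = {(3 * k, 3 * k + 1), (3 * k + 1, 3 * k), (3 * k + 1, 3 * k + 2), (3 * k + 2, 3 * k + 1)} \<rparr>"

lemma pair_graphI:
  fixes G :: "'a pair_pre_digraph"
  assumes "finite (pverts G)"
    and "parcs G \<subseteq> pverts G \<times> pverts G"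
    and "\<And>u v. (u, v) \<in> parcs G \<Longrightarrow> u \<noteq> v \<and> (v, u) \<in> parcs G"
  shows "pair_graph G"
proof
  show "finite (parcs G)"
    using assms(1,2) by (meson finite_SigmaI finite_subset)
  show "symmetric G"
    using assms(3) by (auto simp: symmetric_def sym_def)
qed (use assms in auto)

lemma wf_digraph_pair_graph:
  assumes "pair_graph G"
  shows "wf_digraph G"
proof -
  interpret pair_graph G by fact
  show ?thesis by unfold_locales
qed

lemma pair_graph_P3_chain: "pair_graph (P3_chain m)"
  by (rule pair_graphI) (auto simp: P3_chain_def)

lemma pair_graph_P3_copies: "pair_graph (P3_copies m)"
  by (rule pair_graphI) (auto simp: P3_copies_def)

lemma pair_graph_P3_copy: "pair_graph (P3_copy k)"
  by (rule pair_graphI) (auto simp: P3_copy_def)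

text \<open>A shift by half the length keeps residues mod 3 and changes the half, so it swaps the
  colour classes; on \<open>{..<6 * m}\<close> it is an involution.\<close>

lemma balanced_bipartite_P3_chain: "balanced_bipartite (P3_chain m)"
proof -
  let ?X = "{v. v < 6 * m \<and> colour m v}" and ?Y = "{v. v < 6 * m \<and> \<not> colour m v}"
  let ?f = "\<lambda>v. if v < 3 * m then v + 3 * m else v - 3 * m"
  have flip: "colour m (?f v) = (\<not> colour m v)" if "v < 6 * m" for v
  proof (cases "v < 3 * m")
    case False
    then obtain w where "v = w + 3 * m"
      by (metis le_add_diff_inverse2 not_less)
    with that show ?thesis
      by (auto simp: colour_def)
  qed (auto simp: colour_def)
  have range: "?f v < 6 * m" and inv: "?f (?f v) = v" if "v < 6 * m" for v
    using that by auto
  have "bij_betw ?f ?X ?Y"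
    by (rule bij_betw_byWitness[where f' = ?f]) (use flip range inv in blast)+
  then have "card ?X = card ?Y"
    by (rule bij_betw_same_card)
  then show ?thesis
    unfolding balanced_bipartite_def
    by (intro exI[of _ ?X] exI[of _ ?Y]) (auto simp: P3_chain_def)
qed

section \<open>Maximum degree\<close>

lemma out_degree_pair_pre_digraph:
  fixes G :: "'a pair_pre_digraph"
  shows "out_degree G v = card {w. (v, w) \<in> parcs G}"
proof -
  have "out_arcs G v = Pair v ` {w. (v, w) \<in> parcs G}"
    by (auto simp: out_arcs_def)
  then show ?thesis
    by (simp add: out_degree_def card_image inj_on_def)
qed

lemma max_degree_P3_chain:
  assumes "m \<ge> 3"
  shows "max_degree (P3_chain m) = 4"
  unfolding max_degree_def
proof (rule antisym)
  show "(SUP v\<in>pverts (P3_chain m). out_degree (P3_chain m) v) \<le> 4"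
  proof (rule cSUP_least)
    show "pverts (P3_chain m) \<noteq> {}"
      using assms by (simp add: P3_chain_def lessThan_empty_iff)
    fix v
    \<comment> \<open>The colour condition excludes \<open>v\<close> itself, and truncated
      subtraction can only shrink the lower part of the window.\<close>
    have "{w. (v, w) \<in> parcs (P3_chain m)} \<subseteq> {v..v + 2} \<union> {v - 2..<v} - {v}"
      by (auto simp: P3_chain_def)
    then have "card {w. (v, w) \<in> parcs (P3_chain m)} \<le> card ({v..v + 2} \<union> {v - 2..<v} - {v})"
      by (intro card_mono) auto
    also have "\<dots> = card ({v..v + 2} \<union> {v - 2..<v}) - 1"
      by (subst card_Diff_singleton) auto
    also have "\<dots> \<le> 4"
      using card_Un_le[of "{v..v + 2}" "{v - 2..<v}"] by simp
    finally show "out_degree (P3_chain m) v \<le> 4"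
      by (simp add: out_degree_pair_pre_digraph)
  qed
next
  \<comment> \<open>Vertex 4 is the centre of the second copy. By \<open>m \<ge> 3\<close> the leaf
    6 of the third copy is still in the first half, hence of the other colour.\<close>
  have "{w. (4, w) \<in> parcs (P3_chain m)} = {2, 3, 5, 6}"
    using assms by (auto simp: P3_chain_def colour_def) presburger+
  then have "out_degree (P3_chain m) 4 = 4"
    by (simp add: out_degree_pair_pre_digraph)
  moreover have "out_degree (P3_chain m) 4 \<le> (SUP v\<in>pverts (P3_chain m). out_degree (P3_chain m) v)"
    using assms by (intro cSUP_upper) (auto simp: P3_chain_def)
  ultimately show "4 \<le> (SUP v\<in>pverts (P3_chain m). out_degree (P3_chain m) v)"
    by simp
qed

section \<open>The path factor\<close>

text \<open>Any two vertices are joined through the centre \<open>3 * k + 1\<close>. The predicate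
  \<open>connected\<close> is strong connectivity after symmetrisation, hence
  \<open>mk_symmetric\<close>.\<close>

lemma connected_P3_copy: "connected (P3_copy k)"
proof -
  interpret S: pair_wf_digraph "mk_symmetric (P3_copy k)"
    by unfold_locales (auto simp: mk_symmetric_def P3_copy_def)
  have adj: "(3 * k + 1, v) \<in> parcs (mk_symmetric (P3_copy k))"
       "(v, 3 * k + 1) \<in> parcs (mk_symmetric (P3_copy k))"
    if "v \<in> pverts (P3_copy k)" "v \<noteq> 3 * k + 1" for v
    using that by (auto simp: mk_symmetric_def P3_copy_def)
  have centre: "3 * k + 1 \<in> pverts (mk_symmetric (P3_copy k))"
    by (simp add: mk_symmetric_def P3_copy_def)
  have reach: "(3 * k + 1) \<rightarrow>\<^sup>*\<^bsub>mk_symmetric (P3_copy k)\<^esub> v \<and>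
      v \<rightarrow>\<^sup>*\<^bsub>mk_symmetric (P3_copy k)\<^esub> (3 * k + 1)"
    if "v \<in> pverts (P3_copy k)" for v
  proof (cases "v = 3 * k + 1")
    case True
    then show ?thesis
      using S.reachable_refl[OF centre] by blast
  next
    case False
    then show ?thesis
      using adj[OF that] by (blast intro: S.reachable_adjI)
  qed
  show ?thesis
    unfolding connected_def
  proof (rule strongly_connectedI)
    fix u v assume "u \<in> verts (mk_symmetric (P3_copy k))" "v \<in> verts (mk_symmetric (P3_copy k))"
    then show "u \<rightarrow>\<^sup>*\<^bsub>mk_symmetric (P3_copy k)\<^esub> v"
      using reach S.reachable_trans by (simp add: mk_symmetric_def) blast
  qed (simp add: mk_symmetric_def P3_copy_def)
qed

text \<open>Arcs never leave a block of constant \<open>div 3\<close>, so a connected subgraph lies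
  in one block; as the full block is connected, maximality gives equality.\<close>

lemma is_component_P3_copies:
  assumes "is_component (P3_copies m) C"
  obtains k where "C = P3_copy k"
proof -
  have sub: "subgraph C (P3_copies m)" and conn: "connected C"
    and maxi: "\<And>H. subgraph C H \<Longrightarrow> subgraph H (P3_copies m) \<Longrightarrow> connected H \<Longrightarrow> H = with_proj C"
    using assms unfolding is_component_def pre_digraph.max_subgraph_def by blast+
  have verts_C: "pverts C \<subseteq> {..<6 * m}" and arcs_C: "parcs C \<subseteq> parcs (P3_copies m)"
    using sub by (auto simp: subgraph_def P3_copies_def)
  have wf_C: "wf_digraph C"
    using sub by (simp add: subgraph_def)
  obtain u where u: "u \<in> pverts C"
    using conn by (auto simp: connected_def strongly_connected_def mk_symmetric_def)
  have block: "v div 3 = u div 3" if "v \<in> pverts C" for v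
  proof -
    have "u \<rightarrow>\<^sup>*\<^bsub>mk_symmetric C\<^esub> v"
      using conn u that by (auto simp: connected_def strongly_connected_def mk_symmetric_def)
    then have "(u, v) \<in> (parcs (mk_symmetric C))\<^sup>*"
      unfolding reachable_def by (auto dest: rtrancl_on_rtranclI)
    then show ?thesis
    proof (induction rule: rtrancl_induct)
      case (step y z)
      then have "(y, z) \<in> parcs (P3_copies m) \<or> (z, y) \<in> parcs (P3_copies m)"
        using arcs_C by (auto simp: mk_symmetric_def)
      with step.IH show ?case
        by (auto simp: P3_copies_def)
    qed simp
  qed
  define k where "k = u div 3"
  \<comment> \<open>Since \<open>6 * m\<close> is a multiple of 3, the block of \<open>u\<close> is
    not cut off at the end.\<close>
  have k: "3 * k + 2 < 6 * m"
  proof -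
    have "u < 6 * m"
      using u verts_C by auto
    then show ?thesis
      unfolding k_def by presburger
  qed
  have in_copy: "v \<in> pverts (P3_copy k)" if "v \<in> pverts C" for v
    using block[OF that] by (auto simp: P3_copy_def k_def)
  have "subgraph (P3_copy k) (P3_copies m)"
  proof -
    have "pverts (P3_copy k) \<subseteq> pverts (P3_copies m)" "parcs (P3_copy k) \<subseteq> parcs (P3_copies m)"
      using k by (auto simp: P3_copy_def P3_copies_def div_Suc mod_Suc)
    then show ?thesis
      by (simp add: subgraph_def compatibleI_with_proj wf_digraph_pair_graph pair_graph_P3_copy
          pair_graph_P3_copies)
  qed
  moreover have "subgraph C (P3_copy k)"
  proof -
    have "(a, b) \<in> parcs (P3_copy k)" if "(a, b) \<in> parcs C" for a b
    proof -
      have "a \<in> pverts C" "b \<in> pverts C"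
        using that wf_digraph.wellformed[OF wf_C] by force+
      moreover have "b = Suc a \<or> a = Suc b"
        using that arcs_C by (auto simp: P3_copies_def)
      ultimately show ?thesis
        using in_copy[of a] in_copy[of b] by (auto simp: P3_copy_def)
    qed
    then show ?thesis
      using in_copy wf_C \<open>subgraph (P3_copy k) (P3_copies m)\<close> by (auto simp: subgraph_def)
  qed
  ultimately have "with_proj (P3_copy k) = with_proj C"
    using maxi connected_P3_copy by blast
  then have "C = P3_copy k"
    by (simp add: with_proj_def)
  then show thesis
    by (rule that)
qed

lemma digraph_iso_P3_copy: "digraph_iso (P3_copy k) (path_graph 3)"
proof -
  \<comment> \<open>Truncation does no harm: all vertices of the copy are at least
    \<open>3 * k\<close>.\<close>
  let ?f = "\<lambda>v. v - 3 * k"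
  let ?h = "\<lparr> iso_verts = ?f, iso_arcs = map_prod ?f ?f, iso_head = snd, iso_tail = fst \<rparr>"
  have "pre_digraph.digraph_isomorphism (P3_copy k) ?h"
    unfolding pre_digraph.digraph_isomorphism_def
    using wf_digraph_pair_graph[OF pair_graph_P3_copy[of k]]
    by (auto simp: P3_copy_def inj_on_def)
  moreover have "with_proj (path_graph 3) = app_iso ?h (P3_copy k)"
    by (auto simp: app_iso_def with_proj_def path_graph_def P3_copy_def)
  ultimately show ?thesis
    unfolding digraph_iso_def by blast
qed

lemma has_P2_P3_factor_P3_chain: "has_P2_P3_factor (P3_chain m)"
proof -
  have "colour m u \<noteq> colour m v" if "(u, v) \<in> parcs (P3_copies m)" for u v
  proof -
    have "u div 3 = v div 3" and "v = Suc u \<or> u = Suc v"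
      using that by (auto simp: P3_copies_def)
    \<comment> \<open>Of two consecutive numbers in one block, exactly one is the centre.\<close>
    moreover have "(x mod 3 = 1) \<noteq> (Suc x mod 3 = 1)" if "x div 3 = Suc x div 3" for x :: nat
      using that by presburger
    ultimately have "(u mod 3 = 1) \<noteq> (v mod 3 = 1)"
      by metis
    \<comment> \<open>The halves meet at a multiple of 3, so no block straddles them.\<close>
    moreover have "x < 3 * m \<longleftrightarrow> x div 3 < m" for x
      by (simp add: div_less_iff_less_mult mult.commute)
    then have "u < 3 * m \<longleftrightarrow> v < 3 * m"
      using \<open>u div 3 = v div 3\<close> by simp
    ultimately show ?thesis
      by (simp add: colour_def)
  qed
  then have "parcs (P3_copies m) \<subseteq> parcs (P3_chain m)"
    by (auto simp: P3_chain_def) (auto simp: P3_copies_def)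
  moreover have "wf_digraph (P3_copies m)" "wf_digraph (P3_chain m)"
    by (simp_all add: wf_digraph_pair_graph pair_graph_P3_copies pair_graph_P3_chain)
  ultimately have "spanning (P3_copies m) (P3_chain m)"
    by (auto simp: spanning_def subgraph_def) (auto simp: P3_copies_def P3_chain_def)
  then show ?thesis
    unfolding has_P2_P3_factor_def
    using pair_graph_P3_copies digraph_iso_P3_copy is_component_P3_copies by metis
qed

section \<open>Counting in the product\<close>

lemma not_hamiltonian_P3_chain_product:
  assumes "odd i" and "i < m"
  shows "\<not> hamiltonian (cartesian_product (P3_chain m) (path_graph i))"
proof
  assume ham: "hamiltonian (cartesian_product (P3_chain m) (path_graph i))"
  obtain k where i: "i = 2 * k + 1"
    using \<open>odd i\<close> by (rule oddE)
  define L where "L = {v. v < 3 * m \<and> v mod 3 \<noteq> 1}"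
  define B where "B = {v. v < 3 * m \<and> v mod 3 = 1}"
  define E where "E = {j. j < i \<and> even j}"
  define D where "D = {j. j < i \<and> odd j}"
  have fin: "finite L" "finite B" "finite E" "finite D"
    by (auto simp: L_def B_def E_def D_def)
  have "B = (\<lambda>k. 3 * k + 1) ` {..<m}"
  proof
    show "B \<subseteq> (\<lambda>k. 3 * k + 1) ` {..<m}"
    proof
      fix v assume "v \<in> B"
      then have "v = 3 * (v div 3) + 1" "v div 3 < m"
        by (auto simp: B_def) presburger
      then show "v \<in> (\<lambda>k. 3 * k + 1) ` {..<m}"
        by blast
    qed
  qed (auto simp: B_def mod_Suc)
  then have card_B: "card B = m"
    by (simp add: card_image inj_on_def)
  have "card (L \<union> B) = card L + card B"
    using fin by (intro card_Un_disjoint) (auto simp: L_def B_def)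
  moreover have "L \<union> B = {..<3 * m}"
    by (auto simp: L_def B_def)
  ultimately have card_L: "card L = 2 * m"
    using card_B by simp
  have "E = (\<lambda>j. 2 * j) ` {..k}"
    by (auto simp: E_def i elim!: evenE)
  then have card_E: "card E = k + 1"
    by (simp add: card_image inj_on_def)
  have "D = (\<lambda>j. 2 * j + 1) ` {..<k}"
    by (auto simp: D_def i elim!: oddE)
  then have card_D: "card D = k"
    by (simp add: card_image inj_on_def)
  \<comment> \<open>Leaves outnumber centres two to one and even positions outnumber odd ones by
    one, so \<open>?M\<close> is the larger colour class over the first half. That half is left only
    through vertex \<open>3 * m\<close>, whence the last summand of \<open>?N\<close>.\<close>
  let ?M = "L \<times> E \<union> B \<times> D" and ?N = "(L \<times> D \<union> B \<times> E) \<union> {3 * m} \<times> {..<i}"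
  have "card ?M \<le> card ?N"
  proof (rule hamiltonian_card_le_card_neighbours[OF ham])
    show "?M \<subseteq> pverts (cartesian_product (P3_chain m) (path_graph i))"
      by (auto simp: cartesian_product_def P3_chain_def path_graph_def L_def B_def E_def D_def)
    show "finite ?N"
      using fin by simp
    fix x y assume "x \<in> ?M" and "(x, y) \<in> parcs (cartesian_product (P3_chain m) (path_graph i))"
    then obtain u j v l where x: "x = (u, j)" and y: "y = (v, l)" and M: "(u, j) \<in> ?M"
      and arc: "u = v \<and> (j, l) \<in> parcs (path_graph i) \<or> (u, v) \<in> parcs (P3_chain m) \<and> j = l"
      by (auto simp: cartesian_product_def)
    from arc have "(v, l) \<in> ?N"
    proof
      assume "u = v \<and> (j, l) \<in> parcs (path_graph i)"
      with M show ?thesis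
        by (auto simp: path_graph_def L_def B_def E_def D_def)
    next
      assume a: "(u, v) \<in> parcs (P3_chain m) \<and> j = l"
      have "v = 3 * m" if "v \<ge> 3 * m"
      proof -
        have "u < 3 * m" "v \<le> u + 2" "colour m u \<noteq> colour m v"
          using a M by (auto simp: P3_chain_def L_def B_def)
        show ?thesis
        proof (rule ccontr)
          \<comment> \<open>The only other candidate is \<open>3 * m + 1\<close>, reached from
            \<open>3 * m - 1\<close>: a centre of the second half and a leaf of the first, which
            share a colour.\<close>
          assume "v \<noteq> 3 * m"
          with that \<open>u < 3 * m\<close> \<open>v \<le> u + 2\<close> have "v = 3 * m + 1" "u = 3 * (m - 1) + 2"
            by linarith+
          moreover from this have "u mod 3 \<noteq> 1" "v mod 3 = 1"
            by (simp_all add: mod_Suc)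
          ultimately show False
            using \<open>u < 3 * m\<close> \<open>colour m u \<noteq> colour m v\<close> by (simp add: colour_def)
        qed
      qed
      moreover have "(v mod 3 = 1) \<noteq> (u mod 3 = 1)" if "v < 3 * m"
        using a M that by (auto simp: P3_chain_def colour_def L_def B_def)
      ultimately show ?thesis
        using a M by (cases "v < 3 * m") (auto simp: L_def B_def E_def D_def)
    qed
    then show "y \<in> ?N"
      by (simp add: y)
  qed
  moreover have "card ?M = 2 * m * (k + 1) + m * k"
  proof -
    have "card ?M = card (L \<times> E) + card (B \<times> D)"
      using fin by (intro card_Un_disjoint) (auto simp: L_def B_def)
    then show ?thesis
      by (simp add: card_cartesian_product card_B card_L card_E card_D)
  qed
  moreover have "card ?N \<le> 2 * m * k + m * (k + 1) + i"
  proof -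
    have "card ?N \<le> card (L \<times> D) + card (B \<times> E) + card ({3 * m} \<times> {..<i})"
      by (meson add_le_mono1 card_Un_le order_trans)
    then show ?thesis
      by (simp add: card_cartesian_product card_B card_L card_E card_D)
  qed
  \<comment> \<open>Without its summand \<open>i\<close> the bound is \<open>m\<close> less than
    \<open>card ?M\<close>, so \<open>m \<le> i\<close> would follow.\<close>
  ultimately show False
    using \<open>i < m\<close> by (simp add: algebra_simps)
qed

theorem theorem1p5:
  fixes n :: nat
  assumes "n > 0"
  shows "\<exists>G :: nat pair_pre_digraph.
    pair_graph G \<and> balanced_bipartite G \<and> max_degree G = 4 \<and> has_P2_P3_factor G \<and>
    (\<forall>i. odd i \<and> 0 < i \<and> i \<le> n \<longrightarrow> \<not> hamiltonian (cartesian_product G (path_graph i)))"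
proof (intro exI conjI)
  \<comment> \<open>The choice \<open>n + 2\<close> exceeds every \<open>i \<le> n\<close> and, as
    \<open>n > 0\<close>, is at least 3, as degree four requires.\<close>
  show "max_degree (P3_chain (n + 2)) = 4"
    using assms by (intro max_degree_P3_chain) simp
  show "\<forall>i. odd i \<and> 0 < i \<and> i \<le> n \<longrightarrow>
      \<not> hamiltonian (cartesian_product (P3_chain (n + 2)) (path_graph i))"
    by (simp add: not_hamiltonian_P3_chain_product)
qed (rule pair_graph_P3_chain balanced_bipartite_P3_chain has_P2_P3_factor_P3_chain)+

end
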